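(* Let $(a_n,b_n)_{n \geq 1}$ be a Jacobi-Perron-admissible sequence, let $P_0=U$ and for $n \geq 1$ let $P_n = \Sigma^{\mathsf{JP}}_{a_1,b_1} \cdots \Sigma^{\mathsf{JP}}_{a_n,b_n}(U)$. Then $(P_n)_{n\geq 0}$ is an increasing sequence of patterns contained in the discrete plane $\Gamma_{\mathbf v}$, where $\mathbf v \in \mathbb R^3_{>0}$ is the vector (unique up to positive scaling) whose Jacobi-Perron expansion is $(a_n,b_n)_{n \geq 1}$. Moreover, $\bigcup_{n\geq 0} P_n \subsetneq \Gamma_{\mathbf v}$ if and only if there exists $\ell \geq 1$ such that for every $k \geq 0$ we have (1) $a_{\ell+3k} = 0$, (2) $a_{\ell+3k+1} = b_{\ell+3k+1}$ and (3) $0 < a_{\ell+3k+2} < b_{\ell+3k+2}$.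
   Context: Let $(\mathbf e_1,\mathbf e_2,\mathbf e_3)$ be the canonical basis of $\mathbb R^3$. For $\mathbf x\in\mathbb Z^3$ and $i\in\{1,2,3\}$, the face $[\mathbf x,i]^\star$ is the unit square $\{\mathbf x+\lambda\mathbf e_j+\mu\mathbf e_k:\lambda,\mu\in[0,1]\}$ where $\{i,j,k\}=\{1,2,3\}$. A pattern is a finite union of faces. Let $U=[\mathbf 0,1]^\star\cup[\mathbf 0,2]^\star\cup[\mathbf 0,3]^\star$. For $\mathbf v\in\mathbb R^3_{>0}$, the discrete plane $\Gamma_{\mathbf v}$ is the union of the faces $[\mathbf x,i]^\star$ with $0\le\langle\mathbf x,\mathbf v\rangle<\langle\mathbf e_i,\mathbf v\rangle$. Dual substitutions. For a substitution $\sigma$ on $\{1,2,3\}$, let $\mathbf P(w)=(|w|_1,|w|_2,|w|_3)$ be the abelianization of a word $w$, and $\mathbf M_\sigma$ the matrix whose $i$th column is $\mathbf P(\sigma(i))$. If $\det\mathbf M_\sigma=\pm1$, then $$\mathbf E_1^\star(\sigma)([\mathbf x,i]^\star)=\bigcup_{(p,j,s):\ \sigma(j)=pis}[\mathbf M_\sigma^{-1}(\mathbf x+\mathbf P(s)),j]^\star,$$ extended to unions of faces by taking unions. Products of dual substitutions denote compositions of maps. Jacobi-Perron substitutions: $\sigma^{\mathsf{JP}}_{a,b}:1\mapsto3,2\mapsto13^a,3\mapsto23^b$ for integers $a,b\ge0$; $\Sigma^{\mathsf{JP}}_{a,b}=\mathbf E_1^\star(\sigma^{\mathsf{JP}}_{a,b})$.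 Jacobi-Perron expansion. For $\mathbf v$ with $\mathbf v_1\le\mathbf v_3$ and $\mathbf v_2\le\mathbf v_3$, the Jacobi-Perron algorithm iterates the map $\mathbf v\mapsto(\mathbf v_2-a\mathbf v_1,\ \mathbf v_3-b\mathbf v_1,\ \mathbf v_1)$ with $a=\lfloor\mathbf v_2/\mathbf v_1\rfloor$, $b=\lfloor\mathbf v_3/\mathbf v_1\rfloor$; the expansion of $\mathbf v$ is the sequence $(a_n,b_n)_{n\ge1}$ of pairs $(a,b)$ so obtained. A sequence $(a_n,b_n)_{n\ge1}$ of pairs of integers is Jacobi-Perron-admissible if for every $n\ge1$: $0\le a_n\le b_n$, $b_n\ne0$, and $a_n=b_n$ implies $a_{n+1}\ne0$. Every admissible sequence is the expansion of a vector that is unique up to positive scaling. *)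

theory Defs
  imports "HOL-Analysis.Analysis"
begin

section \<open>Faces, patterns and discrete planes\<close>

text \<open>The index set $\{1,2,3\}$ is the three-element type \<^typ>\<open>3\<close> (in which the
  numeral \<open>3\<close> coincides with \<open>0\<close>). Faces, patterns and discrete planes are sets of points of
  \<^typ>\<open>real^3\<close>.\<close>

definition rvec :: "int^3 \<Rightarrow> real^3" where
  "rvec x = (\<chi> k. of_int (x $ k))"

definition face :: "int^3 \<Rightarrow> 3 \<Rightarrow> (real^3) set" where
  "face x i = {rvec x + l *\<^sub>R axis j 1 + m *\<^sub>R axis k 1 | l m j k.
     {i, j, k} = {1, 2, 3} \<and> l \<in> {0..1} \<and> m \<in> {0..1}}"

definition is_pattern :: "(real^3) set \<Rightarrow> bool" where
  "is_pattern P \<longleftrightarrow> (\<exists>F. finite F \<and> P = (\<Union>(x, i)\<in>F. face x i))"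

definition U :: "(real^3) set" where
  "U = face 0 1 \<union> face 0 2 \<union> face 0 3"

definition discrete_plane :: "real^3 \<Rightarrow> (real^3) set" where
  "discrete_plane v =
     (\<Union>(x, i) \<in> {(x, i). 0 \<le> inner (rvec x) v \<and> inner (rvec x) v < inner (axis i 1) v}. face x i)"

section \<open>Dual substitutions\<close>

text \<open>A substitution is given by the images of the three letters.\<close>

type_synonym subst = "3 \<Rightarrow> 3 list"

definition abel :: "3 list \<Rightarrow> int^3" where
  "abel w = (\<chi> k. int (count_list w k))"

definition incidence :: "subst \<Rightarrow> int^3^3" where
  "incidence \<sigma> = (\<chi> r c. abel (\<sigma> c) $ r)"

text \<open>The inverse is taken over the integers, so the following is meaningful only when
  \<^term>\<open>det (incidence \<sigma>)\<close> is $\pm 1$; see \<open>det_incidence_JP\<close> below.\<close>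

definition E1_face :: "subst \<Rightarrow> int^3 \<Rightarrow> 3 \<Rightarrow> (real^3) set" where
  "E1_face \<sigma> x i =
     (\<Union>(p, j, s) \<in> {(p, j, s). \<sigma> j = p @ [i] @ s}.
        face (matrix_inv (incidence \<sigma>) *v (x + abel s)) j)"

text \<open>The extension to unions of faces. A union of faces contains no other faces than those
  it is made of, so taking all faces contained in the set is the same as taking the faces of any
  presentation of it as a union; see \<open>E1_star_Union\<close> below.\<close>

definition E1_star :: "subst \<Rightarrow> (real^3) set \<Rightarrow> (real^3) set" where
  "E1_star \<sigma> P = (\<Union>(x, i) \<in> {(x, i). face x i \<subseteq> P}. E1_face \<sigma> x i)"

lemma mem_face_iff:
  "p \<in> face x i \<longleftrightarrow>
     p $ i = of_int (x $ i) \<and> (\<forall>j. j \<noteq> i \<longrightarrow> of_int (x $ j) \<le> p $ j \<and> p $ j \<le> of_int (x $ j) + 1)"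
proof
  assume "p \<in> face x i"
  then obtain l m j k where p: "p = rvec x + l *\<^sub>R axis j 1 + m *\<^sub>R axis k 1"
    and ijk: "{i, j, k} = {1, 2, 3}" and lm: "l \<in> {0..1}" "m \<in> {0..1}"
    unfolding face_def by blast
  have "card {i, j, k} = 3"
    unfolding ijk by simp
  hence "i \<noteq> j" "i \<noteq> k" "j \<noteq> k"
    by (auto simp: card_insert_if split: if_splits)
  then show "p $ i = of_int (x $ i) \<and>
      (\<forall>j. j \<noteq> i \<longrightarrow> of_int (x $ j) \<le> p $ j \<and> p $ j \<le> of_int (x $ j) + 1)"
    using lm by (auto simp: p rvec_def axis_def)
next
  assume *: "p $ i = of_int (x $ i) \<and>
      (\<forall>j. j \<noteq> i \<longrightarrow> of_int (x $ j) \<le> p $ j \<and> p $ j \<le> of_int (x $ j) + 1)"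
  have "\<exists>j k. {i, j, k} = {1, 2, 3} \<and> i \<noteq> j \<and> i \<noteq> k \<and> j \<noteq> k"
  proof -
    have "i = 1 \<or> i = 2 \<or> i = 3" by (rule exhaust_3)
    then show ?thesis
    proof (elim disjE)
      assume "i = 1" then show ?thesis by (intro exI[of _ 2] exI[of _ 3]) simp
    next
      assume "i = 2" then show ?thesis by (intro exI[of _ 1] exI[of _ 3]) auto
    next
      assume "i = 3" then show ?thesis by (intro exI[of _ 1] exI[of _ 2]) auto
    qed
  qed
  then obtain j k where ijk: "{i, j, k} = {1, 2, 3}" and ne: "i \<noteq> j" "i \<noteq> k" "j \<noteq> k"
    by blast
  have all: "r = i \<or> r = j \<or> r = k" for r
    using exhaust_3[of r] ijk by blast
  have "p = rvec x + (p $ j - of_int (x $ j)) *\<^sub>R axis j 1 + (p $ k - of_int (x $ k)) *\<^sub>R axis k 1"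
    unfolding vec_eq_iff
  proof
    fix r
    show "p $ r = (rvec x + (p $ j - of_int (x $ j)) *\<^sub>R axis j 1
        + (p $ k - of_int (x $ k)) *\<^sub>R axis k 1) $ r"
      using all[of r] ne * by (auto simp: rvec_def axis_def)
  qed
  moreover have "p $ j - of_int (x $ j) \<in> {0..1}" "p $ k - of_int (x $ k) \<in> {0..1}"
    using * ne by (auto simp: algebra_simps)
  ultimately show "p \<in> face x i"
    unfolding face_def using ijk by blast
qed

lemma face_subset_Union_iff:
  "face x i \<subseteq> (\<Union>(y, j)\<in>F. face y j) \<longleftrightarrow> (x, i) \<in> F"
proof
  define c :: "real^3" where "c = (\<chi> k. of_int (x $ k) + (if k = i then 0 else 1/2))"
  assume "face x i \<subseteq> (\<Union>(y, j)\<in>F. face y j)"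
  moreover have "c \<in> face x i"
    by (auto simp: mem_face_iff c_def)
  ultimately obtain y j where yj: "(y, j) \<in> F" "c \<in> face y j"
    by auto
  have no_half: "of_int m + 1/2 \<noteq> (of_int n :: real)" for m n
  proof
    assume "of_int m + 1/2 = (of_int n :: real)"
    hence "of_int (2 * m + 1) = (of_int (2 * n) :: real)" by simp
    hence "2 * m + 1 = 2 * n" unfolding of_int_eq_iff .
    thus False by presburger
  qed
  have ji: "j = i"
  proof (rule ccontr)
    assume "j \<noteq> i"
    then show False
      using yj(2) no_half[of "x $ j" "y $ j"] by (auto simp: mem_face_iff c_def)
  qed
  have "y $ k = x $ k" for k
  proof (cases "k = i")
    case True
    then show ?thesis using yj(2) ji by (auto simp: mem_face_iff c_def)
  next
    case False
    then have "of_int (y $ k) \<le> (of_int (x $ k) + 1/2 :: real)"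
      "of_int (x $ k) + 1/2 \<le> (of_int (y $ k) + 1 :: real)"
      using yj(2) ji by (auto simp: mem_face_iff c_def)
    then show ?thesis by linarith
  qed
  hence "y = x"
    by (simp add: vec_eq_iff)
  then show "(x, i) \<in> F"
    using yj(1) ji by simp
qed auto

lemma E1_star_Union:
  "E1_star \<sigma> (\<Union>(x, i)\<in>F. face x i) = (\<Union>(x, i)\<in>F. E1_face \<sigma> x i)"
  unfolding E1_star_def face_subset_Union_iff by simp

section \<open>Jacobi-Perron substitutions and the Jacobi-Perron algorithm\<close>

definition sigma_JP :: "nat \<Rightarrow> nat \<Rightarrow> subst" where
  "sigma_JP a b j =
     (if j = 1 then [3] else if j = 2 then 1 # replicate a 3 else 2 # replicate b 3)"

definition Sigma_JP :: "nat \<Rightarrow> nat \<Rightarrow> (real^3) set \<Rightarrow> (real^3) set" where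
  "Sigma_JP a b = E1_star (sigma_JP a b)"

lemma count_list_replicate_JP:
  "count_list (replicate n y) x = (if x = y then n else 0)"
  by (induction n) auto

lemma det_incidence_JP: "det (incidence (sigma_JP a b)) = 1"
  by (simp add: det_3 incidence_def abel_def sigma_JP_def count_list_replicate_JP)

text \<open>All sequences are indexed from 1; their values at 0 are irrelevant.\<close>

primrec Sigma_JP_prod ::
    "(nat \<Rightarrow> nat) \<Rightarrow> (nat \<Rightarrow> nat) \<Rightarrow> nat \<Rightarrow> (real^3) set \<Rightarrow> (real^3) set" where
  "Sigma_JP_prod a b 0 = id"
| "Sigma_JP_prod a b (Suc n) = Sigma_JP_prod a b n \<circ> Sigma_JP (a (Suc n)) (b (Suc n))"

definition JP_map :: "real^3 \<Rightarrow> real^3" where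
  "JP_map v = vector [v $ 2 - of_int \<lfloor>v $ 2 / v $ 1\<rfloor> * v $ 1,
                      v $ 3 - of_int \<lfloor>v $ 3 / v $ 1\<rfloor> * v $ 1,
                      v $ 1]"

text \<open>An infinite expansion requires the divisor, i.e. the first coordinate, to be nonzero
  (for positive \<open>v\<close>: positive) at every step.\<close>

definition JP_expansion :: "real^3 \<Rightarrow> (nat \<Rightarrow> nat) \<Rightarrow> (nat \<Rightarrow> nat) \<Rightarrow> bool" where
  "JP_expansion v a b \<longleftrightarrow>
     v $ 1 \<le> v $ 3 \<and> v $ 2 \<le> v $ 3 \<and>
     (\<forall>n\<ge>1. let w = (JP_map ^^ (n - 1)) v in
        w $ 1 \<noteq> 0 \<and> int (a n) = \<lfloor>w $ 2 / w $ 1\<rfloor> \<and> int (b n) = \<lfloor>w $ 3 / w $ 1\<rfloor>)"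

definition JP_admissible :: "(nat \<Rightarrow> nat) \<Rightarrow> (nat \<Rightarrow> nat) \<Rightarrow> bool" where
  "JP_admissible a b \<longleftrightarrow>
     (\<forall>n\<ge>1. 0 \<le> a n \<and> a n \<le> b n \<and> b n \<noteq> 0 \<and> (a n = b n \<longrightarrow> a (n + 1) \<noteq> 0))"

end

(*
A face of Gamma_v lies in the image of exactly one face, its parent, of the plane of the next
Jacobi-Perron iterate of v, so it lies in P_n iff its n-th ancestor lies in U. Parents of faces
whose base points are at sup-distance at most 1 are again at sup-distance at most 1, and every face
is linked to the origin by such steps inside Gamma_v. Hence P_n exhausts Gamma_v as soon as, at every
level, the faces with base point in {-1,0,1}^3 have an ancestor in U. The base points of successive
ancestors are overlapping windows (y_n, y_{n+1}, y_{n+2}) of one integer sequence; if the sequence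
stays in {-1,0,1} and the window never vanishes, it must be eventually -1,1,1,-1,1,1,..., and this
forces the exceptional digits. Conversely the exceptional digits make the face ((-1,1,1), 3) its own
third ancestor.
*)

theory Submission imports Defs begin

section \<open>Combinatorial faces and their parents\<close>

type_synonym cface = "(int^3) \<times> 3"

definition realize :: "cface set \<Rightarrow> (real^3) set" where
  "realize F = (\<Union>(x, i)\<in>F. face x i)"

text \<open>A union of faces contains no other face (\<open>face_subset_Union_iff\<close>), so the
  inclusions of the theorem, strict ones included, can be tested on index sets.\<close>

lemma realize_subset_iff: "realize F \<subseteq> realize G \<longleftrightarrow> F \<subseteq> G"
proof
  assume *: "realize F \<subseteq> realize G"
  show "F \<subseteq> G"
  proof
    fix f assume "f \<in> F"
    moreover obtain x i where "f = (x, i)" by (cases f)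
    ultimately have "face x i \<subseteq> realize G" using * unfolding realize_def by blast
    then show "f \<in> G" using \<open>f = (x, i)\<close> by (simp add: realize_def face_subset_Union_iff)
  qed
qed (auto simp: realize_def)

lemma realize_psubset_iff: "realize F \<subset> realize G \<longleftrightarrow> F \<subset> G"
  using realize_subset_iff by (metis less_le_not_le)

lemma realize_UN: "(\<Union>n. realize (F n)) = realize (\<Union>n. F n)"
  by (auto simp: realize_def)

definition U_faces :: "cface set" where
  "U_faces = {0} \<times> UNIV"

lemma U_eq: "U = realize U_faces"
proof -
  have "realize U_faces = (\<Union>i. face 0 i)"
    by (auto simp: realize_def U_faces_def)
  also have "\<dots> = face 0 1 \<union> face 0 2 \<union> face 0 3"
    unfolding UNIV_3 by blast
  finally show ?thesis by (simp add: U_def)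
qed

definition height :: "real^3 \<Rightarrow> int^3 \<Rightarrow> real" where
  "height v x = x$1 * v$1 + x$2 * v$2 + x$3 * v$3"

definition plane :: "real^3 \<Rightarrow> cface set" where
  "plane v = {(x, i). 0 \<le> height v x \<and> height v x < v$i}"

lemma discrete_plane_eq: "discrete_plane v = realize (plane v)"
proof -
  have "inner (axis i 1) v = v$i" for i
    by (simp add: inner_axis')
  moreover have "inner (rvec x) v = height v x" for x
    by (simp add: inner_vec_def sum_3 rvec_def height_def)
  ultimately show ?thesis
    by (simp add: discrete_plane_def realize_def plane_def)
qed

section \<open>Dual Jacobi-Perron substitutions as a parent relation\<close>

text \<open>A face \<open>(y, j)\<close> belongs to the image of \<open>(x, i)\<close> under $\Sigma^{\mathsf{JP}}_{a,b}$ iff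
  $x = M y - c\,e_3$, where \<open>c\<close> is the number of letters \<open>3\<close> after the chosen occurrence of \<open>i\<close>
  in the image of \<open>j\<close>.\<close>

definition parent :: "nat \<Rightarrow> nat \<Rightarrow> cface \<Rightarrow> cface \<Rightarrow> bool" where
  "parent a b = (\<lambda>(y, j) (x, i). \<exists>c.
     x$1 = y$2 \<and> x$2 = y$3 \<and> x$3 = y$1 + int a * y$2 + int b * y$3 - int c \<and>
     (j = 1 \<and> i = 3 \<and> c = 0 \<or>
      j = 2 \<and> (i = 3 \<and> c < a \<or> i = 1 \<and> c = a) \<or>
      j = 3 \<and> (i = 3 \<and> c < b \<or> i = 2 \<and> c = b)))"

text \<open>Only the suffix enters the dual substitution, so an occurrence of the repeated letter is
  indexed by the number \<open>c\<close> of letters to its right.\<close>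

lemma Cons_replicate_split:
  "z # replicate n y = p @ [i] @ s \<longleftrightarrow>
    (i = z \<and> p = [] \<and> s = replicate n y \<or>
     (\<exists>c<n. i = y \<and> s = replicate c y \<and> p = z # replicate (n - Suc c) y))"
proof
  assume *: "z # replicate n y = p @ [i] @ s"
  show "i = z \<and> p = [] \<and> s = replicate n y \<or>
     (\<exists>c<n. i = y \<and> s = replicate c y \<and> p = z # replicate (n - Suc c) y)"
  proof (cases p)
    case Nil
    then show ?thesis using * by auto
  next
    case (Cons q p')
    then have r: "replicate n y = p' @ i # s" "q = z" using * by auto
    then have len: "n = length p' + Suc (length s)"
      by (metis length_Cons length_append length_replicate)
    have "\<forall>t\<in>set (p' @ i # s). t = y" unfolding r(1)[symmetric] by auto
    then have "i = y" "s = replicate (length s) y" "p' = replicate (length p') y"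
      using replicate_length_same[of p' y] replicate_length_same[of s y]
      by simp_all
    then show ?thesis using len Cons r(2)
      by (intro disjI2 exI[of _ "length s"]) auto
  qed
next
  assume "i = z \<and> p = [] \<and> s = replicate n y \<or>
     (\<exists>c<n. i = y \<and> s = replicate c y \<and> p = z # replicate (n - Suc c) y)"
  then show "z # replicate n y = p @ [i] @ s"
  proof (elim disjE exE conjE)
    fix c assume c: "c < n" "i = y" "s = replicate c y" "p = z # replicate (n - Suc c) y"
    have "replicate (n - Suc c) y @ y # replicate c y = replicate ((n - Suc c) + Suc c) y"
      by (simp only: replicate_add replicate_Suc)
    then show ?thesis using c by simp
  qed auto
qed

text \<open>The letters 1 and 2 occur only in first position of an image, so what follows any chosen
  letter is a power of 3 and abelianizes to a multiple of the third basis vector.\<close>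

lemma sigma_JP_split:
  "(\<exists>p s. sigma_JP a b j = p @ [i] @ s \<and> abel s = u) \<longleftrightarrow>
   (\<exists>c. u = int c *s axis 3 1 \<and>
     (j = 1 \<and> i = 3 \<and> c = 0 \<or>
      j = 2 \<and> (i = 3 \<and> c < a \<or> i = 1 \<and> c = a) \<or>
      j = 3 \<and> (i = 3 \<and> c < b \<or> i = 2 \<and> c = b)))"
proof -
  have ab: "abel (replicate n 3) = int n *s axis 3 1" for n
    by (auto simp: abel_def vec_eq_iff count_list_replicate_JP axis_def)
  have ab0: "abel [] = int 0 *s axis 3 1"
    by (auto simp: abel_def vec_eq_iff)
  have j: "j = 1 \<or> j = 2 \<or> j = 3" by (rule exhaust_3)
  show ?thesis
    using j
  proof (elim disjE)
    assume "j = 1"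
    moreover have "[3::3] = p @ [i] @ s \<longleftrightarrow> p = [] \<and> i = 3 \<and> s = []" for p s
      by (cases p) auto
    ultimately show ?thesis using ab0 by (auto simp: sigma_JP_def)
  next
    assume "j = 2"
    then show ?thesis
      by (auto simp: sigma_JP_def ab Cons_replicate_split[unfolded append_Cons append_Nil]; blast intro: ab)
  next
    assume "j = 3"
    then show ?thesis
      by (auto simp: sigma_JP_def ab Cons_replicate_split[unfolded append_Cons append_Nil]; blast intro: ab)
  qed
qed

lemma incidence_JP_mult:
  "incidence (sigma_JP a b) *v y = vector [y$2, y$3, y$1 + int a * y$2 + int b * y$3]"
  by (simp add: vec_eq_iff forall_3 matrix_vector_mult_def sum_3 incidence_def abel_def
      sigma_JP_def count_list_replicate_JP)

text \<open>\<open>matrix_inv\<close> is defined by choice, so an explicit two-sided integer inverse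
  is exhibited before its equations are used.\<close>

lemma matrix_inv_incidence_JP:
  "matrix_inv (incidence (sigma_JP a b)) *v u = y \<longleftrightarrow> u = incidence (sigma_JP a b) *v y"
proof -
  let ?M = "incidence (sigma_JP a b)"
  let ?N = "vector [vector [- int a, - int b, 1], vector [1, 0, 0], vector [0, 1, 0]] :: int^3^3"
  have "?M ** ?N = mat 1 \<and> ?N ** ?M = mat 1"
    by (simp add: vec_eq_iff forall_3 matrix_matrix_mult_def sum_3 incidence_def abel_def
      sigma_JP_def count_list_replicate_JP mat_def)
  then have inv: "?M ** matrix_inv ?M = mat 1 \<and> matrix_inv ?M ** ?M = mat 1"
    unfolding matrix_inv_def by (rule someI)
  show ?thesis
    using inv by (metis matrix_vector_mul_assoc matrix_vector_mul_lid)
qed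

lemma E1_face_JP:
  "E1_face (sigma_JP a b) x i = realize {f. parent a b f (x, i)}"
proof -
  have "(\<exists>p s. sigma_JP a b j = p @ [i] @ s \<and>
           matrix_inv (incidence (sigma_JP a b)) *v (x + abel s) = y) \<longleftrightarrow> parent a b (y, j) (x, i)"
    for y j
  proof -
    have "(\<exists>p s. sigma_JP a b j = p @ [i] @ s \<and>
           matrix_inv (incidence (sigma_JP a b)) *v (x + abel s) = y) \<longleftrightarrow>
      (\<exists>p s. sigma_JP a b j = p @ [i] @ s \<and>
           abel s = incidence (sigma_JP a b) *v y - x)"
      unfolding matrix_inv_incidence_JP by (simp add: eq_diff_eq add.commute)
    also have "\<dots> \<longleftrightarrow> parent a b (y, j) (x, i)"
      unfolding sigma_JP_split incidence_JP_mult parent_def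
      by (simp add: vec_eq_iff forall_3 axis_def algebra_simps conj_ac eq_commute[of "x $ _"]
          eq_commute[of "y $ 1 + _"])
    finally show ?thesis .
  qed
  note eq = this
  have "E1_face (sigma_JP a b) x i = realize {(y, j). \<exists>p s. sigma_JP a b j = p @ [i] @ s \<and>
           matrix_inv (incidence (sigma_JP a b)) *v (x + abel s) = y}"
    unfolding E1_face_def realize_def by blast
  also have "{(y, j). \<exists>p s. sigma_JP a b j = p @ [i] @ s \<and>
           matrix_inv (incidence (sigma_JP a b)) *v (x + abel s) = y} = {f. parent a b f (x, i)}"
    unfolding eq by auto
  finally show ?thesis .
qed

lemma Sigma_JP_realize:
  "Sigma_JP a b (realize F) = realize {f. \<exists>g\<in>F. parent a b f g}"
  unfolding Sigma_JP_def realize_def[of F] E1_star_Union E1_face_JP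
  by (auto simp: realize_def)

text \<open>The pair \<open>(c, j)\<close> determines the child, because the base-point equation can
  be solved for \<open>y\<close>. The bound \<open>a + b\<close> covers all cases at once.\<close>

lemma finite_parent: "finite {f. parent a b f g}"
proof -
  obtain x i where g: "g = (x, i)" by (cases g)
  have "{f. parent a b f g} \<subseteq>
    (\<lambda>(c, j). (vector [x$3 - int a * x$1 - int b * x$2 + int c, x$1, x$2], j)) ` ({..a + b} \<times> UNIV)"
  proof
    fix f assume "f \<in> {f. parent a b f g}"
    then obtain y j c where f: "f = (y, j)" "x$1 = y$2" "x$2 = y$3"
      "x$3 = y$1 + int a * y$2 + int b * y$3 - int c" "c \<le> a + b"
      by (auto simp: parent_def g)
    then have "f = (vector [x$3 - int a * x$1 - int b * x$2 + int c, x$1, x$2], j)"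
      by (simp add: vec_eq_iff forall_3)
    then show "f \<in> (\<lambda>(c, j). (vector [x$3 - int a * x$1 - int b * x$2 + int c, x$1, x$2], j)) `
        ({..a + b} \<times> UNIV)"
      using f(5) by (intro image_eqI[of _ _ "(c, j)"]) auto
  qed
  then show ?thesis by (rule finite_subset) simp
qed

text \<open>The factor with index 1 is outermost in the product, so the digits are read in
  increasing order when going from a face to its ancestors.\<close>

primrec ancestor :: "(nat \<Rightarrow> nat) \<Rightarrow> (nat \<Rightarrow> nat) \<Rightarrow> nat \<Rightarrow> cface \<Rightarrow> cface \<Rightarrow> bool" where
  "ancestor a b 0 f g \<longleftrightarrow> f = g"
| "ancestor a b (Suc n) f g \<longleftrightarrow> (\<exists>h. ancestor a b n f h \<and> parent (a (Suc n)) (b (Suc n)) h g)"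

lemma Sigma_JP_prod_realize:
  "Sigma_JP_prod a b n (realize F) = realize {f. \<exists>g\<in>F. ancestor a b n f g}"
\<comment> \<open>\<open>Sigma_JP_prod\<close> grows at its inner end, so the hypothesis is applied
  to the one-step image of \<open>F\<close>.\<close>
proof (induction n arbitrary: F)
  case (Suc n)
  show ?case by (simp add: Sigma_JP_realize Suc) (rule arg_cong[of _ _ realize], blast)
qed simp

lemma finite_ancestor: "finite F \<Longrightarrow> finite {f. \<exists>g\<in>F. ancestor a b n f g}"
proof (induction n arbitrary: F)
  case (Suc n)
  have "finite (\<Union>g\<in>F. {h. parent (a (Suc n)) (b (Suc n)) h g})"
    using Suc.prems finite_parent by blast
  from Suc.IH[OF this] show ?case
    by (rule finite_subset[rotated]) auto
qed simp

text \<open>The last letter of an image has an empty suffix, so \<open>c = 0\<close> keeps the base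
  point 0; that letter is 3 unless the exponent vanishes. This is what makes the patterns
  increase.\<close>

lemma parent_U:
  assumes "f \<in> U_faces" shows "\<exists>g\<in>U_faces. parent a b f g"
proof -
  obtain j where f: "f = (0, j)" using assms by (auto simp: U_faces_def)
  have "j = 1 \<or> j = 2 \<or> j = 3" by (rule exhaust_3)
  then have "\<exists>i. parent a b (0, j) (0, i)"
  proof (elim disjE)
    assume "j = 1" then show ?thesis by (intro exI[of _ 3]) (simp add: parent_def)
  next
    assume "j = 2" then show ?thesis
      by (intro exI[of _ "if a = 0 then 1 else 3"]) (simp add: parent_def)
  next
    assume "j = 3" then show ?thesis
      by (intro exI[of _ "if b = 0 then 2 else 3"]) (simp add: parent_def)
  qed
  then show ?thesis by (auto simp: f U_faces_def)
qed

lemma incseq_ancestor_U: "incseq (\<lambda>n. {f. \<exists>g\<in>U_faces. ancestor a b n f g})"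
  unfolding incseq_Suc_iff using parent_U by fastforce

section \<open>Ancestors in the planes of the Jacobi-Perron iterates\<close>

text \<open>Division with remainder; the upper bound on \<open>t\<close> keeps the quotient below
  \<open>N\<close>.\<close>

lemma ex_digit:
  fixes s t :: real and N :: nat
  assumes "0 < s" "0 \<le> t" "t < real N * s"
  shows "\<exists>c<N. real c * s \<le> t \<and> t < real c * s + s"
proof (intro exI conjI)
  let ?c = "nat \<lfloor>t / s\<rfloor>"
  have c: "real ?c \<le> t / s" "t / s < real ?c + 1" using assms by auto
  show 1: "real ?c * s \<le> t" using c(1) assms(1) by (simp add: le_divide_eq)
  show "t < real ?c * s + s" using c(2) assms(1) by (simp add: divide_less_eq algebra_simps)
  have "real ?c * s < real N * s" using 1 assms(3) by linarith
  then show "?c < N" using assms(1) by simp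
qed

lemma adjust_third:
  fixes s t :: real
  assumes "- s \<le> t" "t < 2 * s"
  shows "\<exists>e. \<bar>e\<bar> \<le> (1::int) \<and> 0 \<le> t + e * s \<and> t + e * s < s"
proof -
  consider "t < 0" | "0 \<le> t" "t < s" | "s \<le> t" by linarith
  then show ?thesis
  proof cases
    case 1 then show ?thesis using assms by (intro exI[of _ 1]) simp
  next
    case 2 then show ?thesis by (intro exI[of _ 0]) simp
  next
    case 3 then show ?thesis using assms by (intro exI[of _ "-1"]) simp
  qed
qed

definition near :: "int^3 \<Rightarrow> int^3 \<Rightarrow> bool" where
  "near x y \<longleftrightarrow> (\<forall>k. \<bar>x$k - y$k\<bar> \<le> 1)"

text \<open>The algorithm is recorded backwards, each iterate being the transposed incidence matrix
  applied to the next one, so no floor occurs. \<open>less_third\<close> starts at level 1, where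
  the first two coordinates are remainders and the third is the divisor.\<close>

locale JP_orbit =
  fixes a b :: "nat \<Rightarrow> nat" and w :: "nat \<Rightarrow> real^3"
  assumes pos: "0 < w n $ i"
    and rec1: "w n $ 1 = w (Suc n) $ 3"
    and rec2: "w n $ 2 = w (Suc n) $ 1 + a (Suc n) * w (Suc n) $ 3"
    and rec3: "w n $ 3 = w (Suc n) $ 2 + b (Suc n) * w (Suc n) $ 3"
    and le_third: "w n $ i \<le> w n $ 3"
    and less_third: "w (Suc n) $ 1 < w (Suc n) $ 3" "w (Suc n) $ 2 < w (Suc n) $ 3"
    and a_le_b: "a (Suc n) \<le> b (Suc n)"
    and b_pos: "0 < b (Suc n)"
    and a_eq_b: "a (Suc n) = b (Suc n) \<Longrightarrow> a (Suc (Suc n)) \<noteq> 0"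
begin

abbreviation par :: "nat \<Rightarrow> cface \<Rightarrow> cface \<Rightarrow> bool" where
  "par n \<equiv> parent (a (Suc n)) (b (Suc n))"

text \<open>By transposition, the height of \<open>M y\<close> with respect to
  \<open>w (Suc n)\<close> is that of \<open>y\<close> with respect to \<open>w n\<close>; removing
  \<open>c\<close> third basis vectors accounts for the extra term.\<close>

lemma parE:
  assumes "par n (y, j) (x, i)"
  obtains c where "x$1 = y$2" "x$2 = y$3"
    "x$3 = y$1 + int (a (Suc n)) * y$2 + int (b (Suc n)) * y$3 - int c"
    "j = 1 \<and> i = 3 \<and> c = 0 \<or>
      j = 2 \<and> (i = 3 \<and> c < a (Suc n) \<or> i = 1 \<and> c = a (Suc n)) \<or>
      j = 3 \<and> (i = 3 \<and> c < b (Suc n) \<or> i = 2 \<and> c = b (Suc n))"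
    "height (w n) y = height (w (Suc n)) x + c * w (Suc n) $ 3"
proof -
  obtain c where c: "x$1 = y$2" "x$2 = y$3"
    "x$3 = y$1 + int (a (Suc n)) * y$2 + int (b (Suc n)) * y$3 - int c"
    "j = 1 \<and> i = 3 \<and> c = 0 \<or>
      j = 2 \<and> (i = 3 \<and> c < a (Suc n) \<or> i = 1 \<and> c = a (Suc n)) \<or>
      j = 3 \<and> (i = 3 \<and> c < b (Suc n) \<or> i = 2 \<and> c = b (Suc n))"
    using assms unfolding parent_def by auto
  have "height (w n) y = height (w (Suc n)) x + c * w (Suc n) $ 3"
    unfolding height_def rec1[of n] rec2[of n] rec3[of n] c(1-3) by (simp add: algebra_simps)
  with c show thesis by (rule that)
qed

lemma a_eq_0_iff: "a (Suc n) = 0 \<longleftrightarrow> w n $ 2 < w n $ 1"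
proof
  assume "a (Suc n) = 0"
  then show "w n $ 2 < w n $ 1" using less_third(1)[of n] rec1[of n] rec2[of n] by simp
next
  assume "w n $ 2 < w n $ 1"
  then have "real (a (Suc n)) * w (Suc n) $ 3 < 1 * w (Suc n) $ 3"
    using pos[of "Suc n" 1] rec1[of n] rec2[of n] by simp
  then have "real (a (Suc n)) < 1" using pos[of "Suc n" 3] by (simp only: mult_less_cancel_right)
  then show "a (Suc n) = 0" by simp
qed

text \<open>The pairs \<open>(c, i)\<close> allowed for \<open>j\<close> cut the interval from 0 to
  \<open>w n $ j\<close> into consecutive pieces, starting at \<open>c * w (Suc n) $ 3\<close> and
  of length \<open>w (Suc n) $ i\<close>. The height of a face selects a piece, and the offset in it
  is the height of the parent. Here the pieces stay inside the interval; \<open>ex_par\<close> shows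
  that they cover it, \<open>par_unique\<close> that they are disjoint.\<close>

lemma par_plane:
  assumes "par n f g" "g \<in> plane (w (Suc n))"
  shows "f \<in> plane (w n)"
proof -
  obtain y j x i where fg: "f = (y, j)" "g = (x, i)" by (cases f, cases g)
  obtain c where "x$1 = y$2" "x$2 = y$3"
    "x$3 = y$1 + int (a (Suc n)) * y$2 + int (b (Suc n)) * y$3 - int c"
    and c: "j = 1 \<and> i = 3 \<and> c = 0 \<or>
      j = 2 \<and> (i = 3 \<and> c < a (Suc n) \<or> i = 1 \<and> c = a (Suc n)) \<or>
      j = 3 \<and> (i = 3 \<and> c < b (Suc n) \<or> i = 2 \<and> c = b (Suc n))"
    "height (w n) y = height (w (Suc n)) x + c * w (Suc n) $ 3"
    by (rule parE[OF assms(1)[unfolded fg]])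
  let ?s = "w (Suc n) $ 3"
  have h: "0 \<le> height (w (Suc n)) x" "height (w (Suc n)) x < w (Suc n) $ i"
    using assms(2) by (auto simp: fg plane_def)
  have s: "real c * ?s + ?s \<le> real N * ?s" if "c < N" for N
  proof -
    have "(real c + 1) * ?s \<le> real N * ?s"
      using that pos[of "Suc n" 3] by (intro mult_right_mono) auto
    then show ?thesis by (simp add: algebra_simps)
  qed
  have "0 \<le> real c * ?s" using pos[of "Suc n" 3] by simp
  moreover have "height (w n) y < w n $ j"
    using c(1) h(2) s[of "a (Suc n)"] s[of "b (Suc n)"] pos[of "Suc n" 1] pos[of "Suc n" 2]
    unfolding c(2) by (auto simp: rec1[of n] rec2[of n] rec3[of n])
  ultimately show ?thesis
    using h(1) by (simp add: fg plane_def c(2))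
qed

lemma ex_par:
  assumes "f \<in> plane (w n)"
  shows "\<exists>g \<in> plane (w (Suc n)). par n f g"
proof -
  obtain y j where f: "f = (y, j)" by (cases f)
  have h: "0 \<le> height (w n) y" "height (w n) y < w n $ j"
    using assms by (auto simp: f plane_def)
  let ?s = "w (Suc n) $ 3"
  define x :: "nat \<Rightarrow> int^3" where "x c =
    vector [y$2, y$3, y$1 + int (a (Suc n)) * y$2 + int (b (Suc n)) * y$3 - int c]" for c
  have hx: "height (w (Suc n)) (x c) = height (w n) y - c * ?s" for c
    unfolding height_def rec1[of n] rec2[of n] rec3[of n] by (simp add: x_def algebra_simps)
  have "\<exists>c i. (j = 1 \<and> i = 3 \<and> c = 0 \<or>
      j = 2 \<and> (i = 3 \<and> c < a (Suc n) \<or> i = 1 \<and> c = a (Suc n)) \<or>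
      j = 3 \<and> (i = 3 \<and> c < b (Suc n) \<or> i = 2 \<and> c = b (Suc n))) \<and>
      real c * ?s \<le> height (w n) y \<and> height (w n) y < c * ?s + w (Suc n) $ i"
  proof -
    have "j = 1 \<or> j = 2 \<or> j = 3" by (rule exhaust_3)
    then show ?thesis
    proof (elim disjE)
      assume "j = 1" then show ?thesis
        using h by (intro exI[of _ 0] exI[of _ 3]) (simp add: rec1)
    next
      assume j: "j = 2"
      show ?thesis
      \<comment> \<open>The first \<open>a (Suc n)\<close> pieces have full length
        \<open>?s\<close>; beyond them lies the last piece, of type 1.\<close>
      proof (cases "height (w n) y < a (Suc n) * ?s")
        case True
        from ex_digit[OF pos h(1) True] j show ?thesis by blast
      next
        case False
        then show ?thesis using h j
          by (intro exI[of _ "a (Suc n)"] exI[of _ 1]) (simp add: rec2[of n])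
      qed
    next
      assume j: "j = 3"
      show ?thesis
      proof (cases "height (w n) y < b (Suc n) * ?s")
        case True
        from ex_digit[OF pos h(1) True] j show ?thesis by blast
      next
        case False
        then show ?thesis using h j
          by (intro exI[of _ "b (Suc n)"] exI[of _ 2]) (simp add: rec3[of n])
      qed
    qed
  qed
  then obtain c i where ci: "j = 1 \<and> i = 3 \<and> c = 0 \<or>
      j = 2 \<and> (i = 3 \<and> c < a (Suc n) \<or> i = 1 \<and> c = a (Suc n)) \<or>
      j = 3 \<and> (i = 3 \<and> c < b (Suc n) \<or> i = 2 \<and> c = b (Suc n))"
      "real c * ?s \<le> height (w n) y" "height (w n) y < c * ?s + w (Suc n) $ i"
    by blast
  have "(x c, i) \<in> plane (w (Suc n))" using ci(2,3) by (simp add: plane_def hx)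
  moreover have "par n f (x c, i)"
    using ci(1) unfolding f parent_def by (auto simp: x_def)
  ultimately show ?thesis by blast
qed

lemma par_unique:
  assumes "par n f g" "par n f g'" "g \<in> plane (w (Suc n))" "g' \<in> plane (w (Suc n))"
  shows "g = g'"
proof -
  obtain y j x i x' i' where fg: "f = (y, j)" "g = (x, i)" "g' = (x', i')"
    by (cases f, cases g, cases g')
  let ?s = "w (Suc n) $ 3"
  have h: "0 \<le> height (w (Suc n)) x" "height (w (Suc n)) x < w (Suc n) $ i"
     "0 \<le> height (w (Suc n)) x'" "height (w (Suc n)) x' < w (Suc n) $ i'"
    using assms(3,4) by (auto simp: fg plane_def)
  obtain c where c: "x$1 = y$2" "x$2 = y$3"
    "x$3 = y$1 + int (a (Suc n)) * y$2 + int (b (Suc n)) * y$3 - int c"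
    "j = 1 \<and> i = 3 \<and> c = 0 \<or>
      j = 2 \<and> (i = 3 \<and> c < a (Suc n) \<or> i = 1 \<and> c = a (Suc n)) \<or>
      j = 3 \<and> (i = 3 \<and> c < b (Suc n) \<or> i = 2 \<and> c = b (Suc n))"
    "height (w n) y = height (w (Suc n)) x + c * ?s"
    by (rule parE[OF assms(1)[unfolded fg(1,2)]])
  obtain c' where c': "x'$1 = y$2" "x'$2 = y$3"
    "x'$3 = y$1 + int (a (Suc n)) * y$2 + int (b (Suc n)) * y$3 - int c'"
    "j = 1 \<and> i' = 3 \<and> c' = 0 \<or>
      j = 2 \<and> (i' = 3 \<and> c' < a (Suc n) \<or> i' = 1 \<and> c' = a (Suc n)) \<or>
      j = 3 \<and> (i' = 3 \<and> c' < b (Suc n) \<or> i' = 2 \<and> c' = b (Suc n))"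
    "height (w n) y = height (w (Suc n)) x' + c' * ?s"
    by (rule parE[OF assms(2)[unfolded fg(1,3)]])
  have step: "real k * ?s + ?s \<le> real l * ?s" if "k < l" for k l
  proof -
    have "(real k + 1) * ?s \<le> real l * ?s"
      using that pos[of "Suc n" 3] by (intro mult_right_mono) auto
    then show ?thesis by (simp add: algebra_simps)
  qed
  have "\<not> c < c'"
  proof
    assume l: "c < c'"
    \<comment> \<open>The piece with the smaller index is not the last one, so it has full length
      and ends no later than the other begins.\<close>
    then have "i = 3" using c(4) c'(4) by auto
    then show False using step[OF l] h(2,3) c(5) c'(5) by simp
  qed
  moreover have "\<not> c' < c"
  proof
    assume l: "c' < c"
    then have "i' = 3" using c(4) c'(4) by auto
    then show False using step[OF l] h(1,4) c(5) c'(5) by simp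
  qed
  ultimately have "c = c'" by simp
  then have "x = x'" "i = i'" using c(1-4) c'(1-4) by (auto simp: vec_eq_iff forall_3)
  then show ?thesis by (simp add: fg)
qed

text \<open>Comparing heights for \<open>w (Suc n)\<close> suffices unless both inherited
  differences are -1. In that case the heights for \<open>w n\<close> force \<open>z1 = 1\<close>
  and digit \<open>a (Suc n) = 0\<close>, so that \<open>z = 1 - b (Suc n) - c' + c\<close>, and
  \<open>c\<close> is at most \<open>b (Suc n)\<close>.\<close>

lemma near_third:
  assumes "near y y'" and f: "(y, j) \<in> plane (w n)" "(y', j') \<in> plane (w n)"
    and g: "(x, i) \<in> plane (w (Suc n))" "(x', i') \<in> plane (w (Suc n))"
    and p: "par n (y, j) (x, i)" "par n (y', j') (x', i')"
  shows "x'$3 - x$3 \<le> 1"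
proof -
  obtain c where c: "x$1 = y$2" "x$2 = y$3"
    "x$3 = y$1 + int (a (Suc n)) * y$2 + int (b (Suc n)) * y$3 - int c"
    "c \<le> max (a (Suc n)) (b (Suc n))"
    by (rule parE[OF p(1)]) auto
  obtain c' where c': "x'$1 = y'$2" "x'$2 = y'$3"
    "x'$3 = y'$1 + int (a (Suc n)) * y'$2 + int (b (Suc n)) * y'$3 - int c'"
    by (rule parE[OF p(2)]) auto
  define z1 z2 z3 z where z: "z1 = y'$1 - y$1" "z2 = y'$2 - y$2" "z3 = y'$3 - y$3"
    "z = x'$3 - x$3"
  have small: "z1 \<in> {-1,0,1}" "z2 \<in> {-1,0,1}" "z3 \<in> {-1,0,1}"
    using assms(1) unfolding near_def forall_3 z by (auto simp: abs_le_iff)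
  have cle: "c \<le> b (Suc n)" using c(4) a_le_b[of n] by simp
  have zeq: "z = z1 + int (a (Suc n)) * z2 + int (b (Suc n)) * z3 - int c' + int c"
    unfolding z c(3) c'(3) by (simp add: algebra_simps)
  have hw: "z2 * w (Suc n) $ 1 + z3 * w (Suc n) $ 2 + z * w (Suc n) $ 3 < w (Suc n) $ 3"
  proof -
    have "height (w (Suc n)) x' - height (w (Suc n)) x < w (Suc n) $ 3"
      using g le_third[of "Suc n" i'] by (simp add: plane_def)
    then show ?thesis by (simp add: height_def z c c'(1,2) algebra_simps)
  qed
  have hv: "- w n $ j < z1 * w n $ 1 + z2 * w n $ 2 + z3 * w n $ 3"
  proof -
    have "- w n $ j < height (w n) y' - height (w n) y"
      using f by (simp add: plane_def)
    then show ?thesis by (simp add: height_def z algebra_simps)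
  qed
  show ?thesis
  proof (cases "z2 = -1 \<and> z3 = -1")
    case True
    have j: "j = 1 \<or> j = 2 \<or> j = 3" by (rule exhaust_3)
    have "z1 = 1 \<and> w n $ 2 < w n $ 1"
      using j hv small(1) True pos[of n 1] pos[of n 2] pos[of n 3] le_third[of n 1] le_third[of n 2]
      by auto
    moreover from this have "a (Suc n) = 0" using a_eq_0_iff by blast
    ultimately have "z \<le> 1" using True zeq cle by simp
    then show ?thesis by (simp add: z)
  next
    case False
    define t where "t = z * w (Suc n) $ 3"
    \<comment> \<open>At most one of \<open>z2\<close>, \<open>z3\<close> is negative, which costs
      at most \<open>w (Suc n) $ 3\<close>.\<close>
    have "t < 2 * w (Suc n) $ 3"
      using False hw[folded t_def] small(2,3) pos[of "Suc n" 1] pos[of "Suc n" 2] pos[of "Suc n" 3]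
        le_third[of "Suc n" 1] le_third[of "Suc n" 2]
      by auto
    then have "real_of_int z < 2"
      using pos[of "Suc n" 3] unfolding t_def by (simp only: mult_less_cancel_right)
    then show ?thesis by (simp add: z)
  qed
qed

text \<open>Two coordinates are inherited by the shift; for the third, \<open>near_third\<close> is
  applied in both directions.\<close>

lemma near_par:
  assumes "near (fst f) (fst f')" "f \<in> plane (w n)" "f' \<in> plane (w n)"
    and "g \<in> plane (w (Suc n))" "g' \<in> plane (w (Suc n))" "par n f g" "par n f' g'"
  shows "near (fst g) (fst g')"
proof -
  obtain y j y' j' x i x' i' where fg: "f = (y, j)" "f' = (y', j')" "g = (x, i)" "g' = (x', i')"
    by (cases f, cases f', cases g, cases g')
  have "near y y'" "near y' y" using assms(1) by (auto simp: fg near_def abs_minus_commute)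
  then have "x'$3 - x$3 \<le> 1" "x$3 - x'$3 \<le> 1"
    using near_third assms(2-) unfolding fg by blast+
  moreover have "x$1 = y$2 \<and> x$2 = y$3" "x'$1 = y'$2 \<and> x'$2 = y'$3"
    using assms(6,7) unfolding fg by (auto elim: parE)
  ultimately show ?thesis
    using \<open>near y y'\<close> by (simp add: fg near_def forall_3 abs_le_iff)
qed

section \<open>Orbits of successive parents and their meeting with the origin\<close>

definition orbit :: "nat \<Rightarrow> (nat \<Rightarrow> cface) \<Rightarrow> bool" where
  "orbit m f \<longleftrightarrow> (\<forall>n\<ge>m. f n \<in> plane (w n) \<and> par n (f n) (f (Suc n)))"

lemma ex_orbit:
  assumes "f0 \<in> plane (w m)"
  shows "\<exists>f. f m = f0 \<and> orbit m f"
proof -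
  \<comment> \<open>The clause for \<open>k = 0\<close> forces the chosen sequence to start at
    \<open>f0\<close>.\<close>
  have "\<exists>g. \<forall>k. (g k \<in> plane (w (m + k)) \<and> (k = 0 \<longrightarrow> g k = f0)) \<and> par (m + k) (g k) (g (Suc k))"
  proof (rule dependent_nat_choice)
    fix x k assume "x \<in> plane (w (m + k)) \<and> (k = 0 \<longrightarrow> x = f0)"
    then show "\<exists>y. (y \<in> plane (w (m + Suc k)) \<and> (Suc k = 0 \<longrightarrow> y = f0)) \<and> par (m + k) x y"
      using ex_par[of x "m + k"] by auto
  next
    show "\<exists>x. x \<in> plane (w (m + 0)) \<and> (0 = (0::nat) \<longrightarrow> x = f0)"
      by (intro exI[of _ f0]) (simp add: assms)
  qed
  then obtain g where g: "g k \<in> plane (w (m + k))" "g 0 = f0" "par (m + k) (g k) (g (Suc k))" for k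
    by blast
  have "orbit m (\<lambda>n. g (n - m))"
    unfolding orbit_def
  proof (intro allI impI)
    fix n assume "m \<le> n"
    then obtain k where "n = m + k" by (metis le_Suc_ex)
    then show "g (n - m) \<in> plane (w n) \<and> par n (g (n - m)) (g (Suc n - m))"
      using g(1,3)[of k] by (simp add: Suc_diff_le)
  qed
  then show ?thesis using g(2) by (intro exI[of _ "\<lambda>n. g (n - m)"]) simp
qed

lemma near_orbit:
  assumes "orbit m f" "orbit m g" "near (fst (f m)) (fst (g m))" "m \<le> n"
  shows "near (fst (f n)) (fst (g n))"
  using assms(4)
proof (induction n rule: dec_induct)
  case (step n)
  then show ?case using assms(1,2) near_par[of "f n" "g n" n] by (simp add: orbit_def)
qed (rule assms(3))

lemma orbit_mono: "orbit m f \<Longrightarrow> m \<le> n \<Longrightarrow> orbit n f"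
  by (auto simp: orbit_def)

text \<open>The parent of a face at 0 is based at \<open>-c\<close> times the third basis vector,
  and nonnegative height forces \<open>c = 0\<close>. So the origin is absorbing.\<close>

lemma zero_par:
  assumes "par n f g" "g \<in> plane (w (Suc n))" "fst f = 0"
  shows "fst g = 0"
proof -
  obtain j x i where fg: "f = (0, j)" "g = (x, i)" using assms(3) by (cases f, cases g) auto
  obtain c where c: "x$1 = 0" "x$2 = 0" "x$3 = - int c"
    by (rule parE[OF assms(1)[unfolded fg]]) auto
  have "0 \<le> height (w (Suc n)) x" using assms(2) by (simp add: fg plane_def)
  then have "0 \<le> - real c * w (Suc n) $ 3" by (simp add: height_def c)
  then have "real c \<le> 0"
    using pos[of "Suc n" 3] by (simp add: mult_le_0_iff)
  then show ?thesis using c by (simp add: fg vec_eq_iff forall_3)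
qed

lemma zero_orbit:
  assumes "orbit m f" "fst (f m) = 0" "m \<le> n"
  shows "fst (f n) = 0"
  using assms(3)
proof (induction n rule: dec_induct)
  case (step n)
  then show ?case using assms(1) zero_par[of n "f n" "f (Suc n)"] by (simp add: orbit_def)
qed (rule assms(2))

lemma zero_mem_plane: "(0, i) \<in> plane (w n)"
  by (simp add: plane_def height_def pos)

text \<open>Moving one of the first two coordinates a unit towards 0 changes the height by at most
  \<open>w n $ 3\<close>, which a change of the third coordinate by at most 1 repairs. Type 3 is
  chosen because it allows the widest range of heights.\<close>

lemma plane_descent:
  assumes "(x, i) \<in> plane (w n)" "x$1 \<noteq> 0 \<or> x$2 \<noteq> 0"
  shows "\<exists>x'. (x', 3) \<in> plane (w n) \<and> near x x' \<and> \<bar>x'$1\<bar> + \<bar>x'$2\<bar> < \<bar>x$1\<bar> + \<bar>x$2\<bar>"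
proof -
  have "\<exists>d1 d2. \<bar>d1\<bar> + \<bar>d2\<bar> \<le> 1 \<and> \<bar>x$1 + d1\<bar> + \<bar>x$2 + d2\<bar> < \<bar>x$1\<bar> + \<bar>x$2\<bar>"
  proof (cases "x$1 = 0")
    case True
    then show ?thesis using assms(2) by (intro exI[of _ 0] exI[of _ "- sgn (x$2)"]) (auto simp: sgn_if)
  next
    case False
    then show ?thesis by (intro exI[of _ "- sgn (x$1)"] exI[of _ 0]) (auto simp: sgn_if)
  qed
  then obtain d1 d2 where d: "\<bar>d1\<bar> + \<bar>d2\<bar> \<le> 1"
    "\<bar>x$1 + d1\<bar> + \<bar>x$2 + d2\<bar> < \<bar>x$1\<bar> + \<bar>x$2\<bar>" by blast
  let ?t = "height (w n) x + d1 * w n $ 1 + d2 * w n $ 2"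
  have h: "0 \<le> height (w n) x" "height (w n) x < w n $ 3"
    using assms(1) le_third[of n i] by (auto simp: plane_def)
  have "(d1, d2) \<in> {(0,0),(1,0),(-1,0),(0,1),(0,-1)}"
    using d(1) by auto
  then have "- (w n $ 3) \<le> ?t" "?t < 2 * w n $ 3"
    using h le_third[of n 1] le_third[of n 2] pos[of n 1] pos[of n 2] pos[of n 3] by auto
  then obtain e :: int where e: "\<bar>e\<bar> \<le> 1" "0 \<le> ?t + e * w n $ 3" "?t + e * w n $ 3 < w n $ 3"
    using adjust_third by blast
  let ?x = "vector [x$1 + d1, x$2 + d2, x$3 + e] :: int^3"
  have "height (w n) ?x = ?t + e * w n $ 3"
    by (simp add: height_def algebra_simps)
  then have "(?x, 3) \<in> plane (w n)" using e by (simp add: plane_def)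
  moreover have "\<bar>d1\<bar> \<le> 1" "\<bar>d2\<bar> \<le> 1" using d(1) by linarith+
  then have "near x ?x" using e(1) by (simp add: near_def forall_3)
  ultimately show ?thesis using d(2) by (intro exI[of _ ?x]) simp
qed

text \<open>Once the orbit of a neighbour closer to the origin has reached 0, the given orbit is at
  distance at most 1 from 0, and the assumption applies from that later level on. Hence the
  assumption ranges over all starting levels.\<close>

lemma orbits_reach_zero:
  assumes *: "\<And>m f. orbit m f \<Longrightarrow> near 0 (fst (f m)) \<Longrightarrow> \<exists>n\<ge>m. fst (f n) = 0"
    and "orbit m f"
  shows "\<exists>n\<ge>m. fst (f n) = 0"
  using assms(2)
proof (induction "nat (\<bar>fst (f m) $ 1\<bar> + \<bar>fst (f m) $ 2\<bar>)" arbitrary: f rule: less_induct)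
  case less
  obtain x i where x: "f m = (x, i)" by (cases "f m")
  have xp: "(x, i) \<in> plane (w m)" using less.prems x by (auto simp: orbit_def)
  show ?case
  \<comment> \<open>The third coordinate is absent from the measure: when the other two vanish, the
    height bounds make it 0.\<close>
  proof (cases "x$1 = 0 \<and> x$2 = 0")
    case True
    then have "height (w m) x = x$3 * w m $ 3" by (simp add: height_def)
    moreover have "0 \<le> height (w m) x" "height (w m) x < 1 * w m $ 3"
      using xp le_third[of m i] by (auto simp: plane_def)
    ultimately have "0 \<le> x$3" "real_of_int (x$3) < 1"
      using pos[of m 3] by (simp_all only: mult_less_cancel_right) (auto simp: zero_le_mult_iff)
    then have "x$3 = 0" by simp
    then show ?thesis using True x by (intro exI[of _ m]) (simp add: vec_eq_iff forall_3)
  next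
    case False
    then obtain x' where x': "(x', 3) \<in> plane (w m)" "near x x'"
      "\<bar>x'$1\<bar> + \<bar>x'$2\<bar> < \<bar>x$1\<bar> + \<bar>x$2\<bar>" using plane_descent[OF xp] by blast
    obtain g where g: "g m = (x', 3)" "orbit m g" using ex_orbit[OF x'(1)] by blast
    have "\<exists>n\<ge>m. fst (g n) = 0"
      using x'(3) g by (intro less.hyps) (auto simp: x)
    then obtain n where n: "n \<ge> m" "fst (g n) = 0" by blast
    have "near x' x" using x'(2) by (simp add: near_def abs_minus_commute)
    then have "near (fst (g n)) (fst (f n))"
      using near_orbit[OF g(2) less.prems _ n(1)] by (simp add: g x)
    then obtain k where "k \<ge> n" "fst (f k) = 0"
      using *[OF orbit_mono[OF less.prems n(1)]] n(2) by auto
    then show ?thesis using n(1) by (meson order_trans)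
  qed
qed

section \<open>Orbits that avoid the origin\<close>

text \<open>The first two coordinates of the vector are positive and strictly below the third, so a
  height between 0 and the third one leaves a single value for \<open>x$3\<close> in each
  case.\<close>

lemma plane_third:
  assumes "(x, i) \<in> plane (w (Suc n))"
  shows "x$1 = 0 \<Longrightarrow> x$2 = 0 \<Longrightarrow> x$3 = 0"
    and "x$1 = 1 \<Longrightarrow> x$2 = 0 \<Longrightarrow> x$3 = 0"
    and "x$1 = -1 \<Longrightarrow> x$2 = 0 \<Longrightarrow> x$3 = 1"
    and "x$1 = 0 \<Longrightarrow> x$2 = 1 \<Longrightarrow> x$3 = 0"
    and "\<bar>x$3\<bar> = 1 \<Longrightarrow> x$1 = 1 \<Longrightarrow> x$2 = 1 \<Longrightarrow> x$3 = -1"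
    and "\<bar>x$3\<bar> = 1 \<Longrightarrow> x$1 = 1 \<Longrightarrow> x$2 = -1 \<Longrightarrow> x$3 = 1"
    and "\<bar>x$3\<bar> = 1 \<Longrightarrow> x$1 = -1 \<Longrightarrow> x$2 = 1 \<Longrightarrow> x$3 = 1"
    and "\<bar>x$3\<bar> = 1 \<Longrightarrow> x$1 = -1 \<Longrightarrow> x$2 = -1 \<Longrightarrow> x$3 = 1"
proof -
  let ?v = "w (Suc n)"
  define t where "t = x$3 * ?v$3"
  have h: "0 \<le> x$1 * ?v$1 + x$2 * ?v$2 + t" "x$1 * ?v$1 + x$2 * ?v$2 + t < ?v$3"
    using assms le_third[of "Suc n" i] by (auto simp: plane_def height_def t_def)
  note v = pos[of "Suc n" 1] pos[of "Suc n" 2] pos[of "Suc n" 3] less_third[of n]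
  have bounds: "l < x$3" if "of_int l * ?v$3 < t" for l
    using that v(3) unfolding t_def by (simp only: mult_less_cancel_right of_int_less_iff)
  have bounds': "x$3 < l" if "t < of_int l * ?v$3" for l
    using that v(3) unfolding t_def by (simp only: mult_less_cancel_right of_int_less_iff)
  show "x$1 = 0 \<Longrightarrow> x$2 = 0 \<Longrightarrow> x$3 = 0"
    using h v bounds[of "-1"] bounds'[of 1] by simp
  show "x$1 = 1 \<Longrightarrow> x$2 = 0 \<Longrightarrow> x$3 = 0"
    using h v bounds[of "-1"] bounds'[of 1] by simp
  show "x$1 = -1 \<Longrightarrow> x$2 = 0 \<Longrightarrow> x$3 = 1"
    using h v bounds[of 0] bounds'[of 2] by simp
  show "x$1 = 0 \<Longrightarrow> x$2 = 1 \<Longrightarrow> x$3 = 0"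
    using h v bounds[of "-1"] bounds'[of 1] by simp
  show "\<bar>x$3\<bar> = 1 \<Longrightarrow> x$1 = 1 \<Longrightarrow> x$2 = 1 \<Longrightarrow> x$3 = -1"
    using h v bounds'[of 1] by (simp add: abs_if split: if_splits)
  show "\<bar>x$3\<bar> = 1 \<Longrightarrow> x$1 = 1 \<Longrightarrow> x$2 = -1 \<Longrightarrow> x$3 = 1"
    using h v bounds[of "-1"] by (simp add: abs_if split: if_splits)
  show "\<bar>x$3\<bar> = 1 \<Longrightarrow> x$1 = -1 \<Longrightarrow> x$2 = 1 \<Longrightarrow> x$3 = 1"
    using h v bounds[of "-1"] by (simp add: abs_if split: if_splits)
  show "\<bar>x$3\<bar> = 1 \<Longrightarrow> x$1 = -1 \<Longrightarrow> x$2 = -1 \<Longrightarrow> x$3 = 1"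
    using h v bounds[of "-1"] by (simp add: abs_if split: if_splits)
qed

section \<open>Digits forced by the cycle of three base points\<close>

definition exceptional :: "nat \<Rightarrow> bool" where
  "exceptional l \<longleftrightarrow> (\<forall>k. a (l + 3 * k) = 0 \<and> a (l + 3 * k + 1) = b (l + 3 * k + 1) \<and>
     0 < a (l + 3 * k + 2) \<and> a (l + 3 * k + 2) < b (l + 3 * k + 2))"

text \<open>The upper height bound, with \<open>w n $ i\<close> at most \<open>w n $ 3\<close>,
  gives \<open>w n $ 2 < w n $ 1\<close>.\<close>

lemma cycle_start:
  assumes "(vector [-1, 1, 1], i) \<in> plane (w n)"
  shows "a (Suc n) = 0"
proof -
  have "w n $ 2 + w n $ 3 < w n $ 1 + w n $ i"
    using assms by (simp add: plane_def height_def)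
  moreover have "i = 1 \<or> i = 2 \<or> i = 3" by (rule exhaust_3)
  ultimately show ?thesis
    using le_third[of n 1] pos[of n 2] unfolding a_eq_0_iff by auto
qed

lemma cycle_conditions:
  assumes f: "orbit n f"
    and x: "fst (f n) = vector [-1, 1, 1]" "fst (f (Suc n)) = vector [1, 1, -1]"
      "fst (f (Suc (Suc n))) = vector [1, -1, 1]" "fst (f (Suc (Suc (Suc n)))) = vector [-1, 1, 1]"
  shows "a (Suc n) = 0 \<and> a (Suc (Suc n)) = b (Suc (Suc n)) \<and>
    0 < a (Suc (Suc (Suc n))) \<and> a (Suc (Suc (Suc n))) < b (Suc (Suc (Suc n)))"
proof -
  obtain i0 i1 i2 i3 where ff: "f n = (vector [-1, 1, 1], i0)"
    "f (Suc n) = (vector [1, 1, -1], i1)" "f (Suc (Suc n)) = (vector [1, -1, 1], i2)"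
    "f (Suc (Suc (Suc n))) = (vector [-1, 1, 1], i3)"
    using x by (metis prod.collapse)
  have p: "f n \<in> plane (w n)" "f (Suc (Suc n)) \<in> plane (w (Suc (Suc n)))"
    "f (Suc (Suc (Suc n))) \<in> plane (w (Suc (Suc (Suc n))))"
    and q: "par n (f n) (f (Suc n))" "par (Suc n) (f (Suc n)) (f (Suc (Suc n)))"
    "par (Suc (Suc n)) (f (Suc (Suc n))) (f (Suc (Suc (Suc n))))"
    using f by (auto simp: orbit_def)
  have a1: "a (Suc n) = 0" using cycle_start p(1) ff by simp
  have a4: "a (Suc (Suc (Suc (Suc n)))) = 0" using cycle_start p(3) ff by simp
  \<comment> \<open>The third-coordinate equation gives \<open>c = b (Suc n)\<close>, which is
    positive while \<open>a (Suc n) = 0\<close>; so the chosen letter is the first one in the image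
    of 3.\<close>
  have "i1 = 2"
    by (rule parE[OF q(1)[unfolded ff]]) (use b_pos[of n] a1 in auto)
  \<comment> \<open>Here the equation reads \<open>c = a - b\<close> for the current digits; since
    \<open>a\<close> is at most \<open>b\<close>, both sides are 0, and the positive exponent makes
    the last letter a 3.\<close>
  have "a (Suc (Suc n)) = b (Suc (Suc n)) \<and> i2 = 3"
    by (rule parE[OF q(2)[unfolded ff]]) (use \<open>i1 = 2\<close> a_le_b[of "Suc n"] b_pos[of "Suc n"] in auto)
  then have a2: "a (Suc (Suc n)) = b (Suc (Suc n))" and "i2 = 3" by auto
  then have "w (Suc (Suc n)) $ 1 < w (Suc (Suc n)) $ 2"
    using p(2) by (simp add: ff plane_def height_def)
  then have a3: "0 < a (Suc (Suc (Suc n)))"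
    using a_eq_0_iff[of "Suc (Suc n)"] by auto
  \<comment> \<open>Equality would make the next digit nonzero by admissibility, contradicting
    \<open>a4\<close>.\<close>
  have "a (Suc (Suc (Suc n))) < b (Suc (Suc (Suc n)))"
    using a_le_b[of "Suc (Suc n)"] a_eq_b[of "Suc (Suc n)"] a4 by linarith
  then show ?thesis using a1 a2 a3 by simp
qed

lemma trapped_orbit_exceptional:
  assumes f: "orbit m f" and near: "near 0 (fst (f m))" and nz: "\<And>n. m \<le> n \<Longrightarrow> fst (f n) \<noteq> 0"
  shows "\<exists>l\<ge>1. exceptional l"
proof -
  define q where "q n i = fst (f n) $ i" for n i
  have plane: "(fst (f n), snd (f n)) \<in> plane (w n)" if "m \<le> n" for n
    using f that by (simp add: orbit_def)
  have shift: "q (Suc n) 1 = q n 2" "q (Suc n) 2 = q n 3" if "m \<le> n" for n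
  proof -
    have "par n (fst (f n), snd (f n)) (fst (f (Suc n)), snd (f (Suc n)))"
      using f that by (simp add: orbit_def)
    then show "q (Suc n) 1 = q n 2" "q (Suc n) 2 = q n 3"
      unfolding q_def by (rule parE; simp)+
  qed
  \<comment> \<open>The orbit is compared with that of a face at the origin, which stays
    there.\<close>
  have small: "q n i \<in> {-1, 0, 1}" if "m \<le> n" for n i
  proof -
    obtain g where g: "g m = (0, 1)" "orbit m g" using ex_orbit[OF zero_mem_plane] by blast
    have "near (fst (g n)) (fst (f n))"
      using near_orbit[OF g(2) f _ that] near g(1) by simp
    moreover have "fst (g n) = 0" using zero_orbit[OF g(2) _ that] g(1) by simp
    ultimately have "\<bar>q n i\<bar> \<le> 1" by (simp add: near_def q_def)
    then show ?thesis by auto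
  qed
  have nonzero: "\<not> (q n 1 = 0 \<and> q n 2 = 0 \<and> q n 3 = 0)" if "m \<le> n" for n
    using nz[OF that] by (simp add: q_def vec_eq_iff forall_3)
  note third = plane_third[OF plane, folded q_def]
  \<comment> \<open>A vanishing third entry leads within a few levels to a window starting with two
    zeros, whose third entry is then 0 as well.\<close>
  have third_nz: "q n 3 \<noteq> 0" if n: "m \<le> n" for n
  proof
    assume "q n 3 = 0"
    then have q1: "q (Suc n) 1 = q n 2" "q (Suc n) 2 = 0" using shift n by auto
    have no10: "\<not> (q (Suc k) 1 = 1 \<and> q (Suc k) 2 = 0)" if k: "m \<le> k" for k
    proof
      assume k1: "q (Suc k) 1 = 1 \<and> q (Suc k) 2 = 0"
      then have "q (Suc k) 3 = 0" using third(2)[of k] k by simp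
      then have "q (Suc (Suc k)) 1 = 0" "q (Suc (Suc k)) 2 = 0" using k1 shift[of "Suc k"] k by auto
      then show False using third(1)[of "Suc k"] nonzero[of "Suc (Suc k)"] k by simp
    qed
    consider "q n 2 = 0" | "q n 2 = 1" | "q n 2 = -1" using small[OF n, of 2] by auto
    then show False
    proof cases
      case 1
      then show False using q1 third(1)[of n] nonzero[of "Suc n"] n by simp
    next
      case 2
      then show False using q1 no10 n by simp
    next
      case 3
      then have "q (Suc n) 3 = 1" using q1 third(3)[of n] n by simp
      then have q2: "q (Suc (Suc n)) 1 = 0" "q (Suc (Suc n)) 2 = 1"
        using q1 shift[of "Suc n"] n by auto
      then have "q (Suc (Suc n)) 3 = 0" using third(4)[of "Suc n"] n by simp
      then show False using q2 shift[of "Suc (Suc n)"] no10[of "Suc (Suc n)"] n by simp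
    qed
  qed
  have unit3: "\<bar>q n 3\<bar> = 1" if "m \<le> n" for n
    using third_nz[OF that] small[OF that, of 3] by auto
  \<comment> \<open>After two shifts the first two entries are former third entries.\<close>
  have unit: "\<bar>q n 1\<bar> = 1" "\<bar>q n 2\<bar> = 1" if "m + 2 \<le> n" for n
  proof -
    obtain k where k: "n = Suc (Suc k)" "m \<le> k"
      using \<open>m + 2 \<le> n\<close> that[of "n - 2"] by simp
    then show "\<bar>q n 1\<bar> = 1" "\<bar>q n 2\<bar> = 1" using unit3 shift[of k] shift[of "Suc k"] by auto
  qed
  have next3: "q n 3 = (if q n 1 = 1 \<and> q n 2 = 1 then -1 else 1)" if "m + 2 \<le> n" for n
  proof -
    obtain k where k: "n = Suc k" using \<open>m + 2 \<le> n\<close> by (cases n) auto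
    have "q n 1 = 1 \<or> q n 1 = -1" "q n 2 = 1 \<or> q n 2 = -1" using unit[OF that] by auto
    moreover have "m \<le> Suc k" using that k by simp
    note t = third(5-8)[OF this unit3[OF this], folded k]
    ultimately show ?thesis using t by (elim disjE) simp_all
  qed
  have step: "q (Suc n) 1 = q n 2 \<and> q (Suc n) 2 = (if q n 1 = 1 \<and> q n 2 = 1 then -1 else 1)"
    if "m + 2 \<le> n" for n using shift[of n] next3[of n] that by simp
  \<comment> \<open>Each of the four sign pairs reaches (-1, 1) within two steps of the
    recursion.\<close>
  have "\<exists>n\<ge>m + 2. q n 1 = -1 \<and> q n 2 = 1"
  proof -
    let ?n = "m + 2"
    have "q ?n 1 = 1 \<or> q ?n 1 = -1" "q ?n 2 = 1 \<or> q ?n 2 = -1" using unit[of ?n] by auto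
    then consider "q ?n 1 = -1 \<and> q ?n 2 = 1" | "q ?n 2 = -1" | "q ?n 1 = 1 \<and> q ?n 2 = 1" by auto
    then show ?thesis
    proof cases
      case 1 then show ?thesis by blast
    next
      case 2 then show ?thesis using step[of ?n] by (intro exI[of _ "Suc ?n"]) simp
    next
      case 3
      then have "q (Suc ?n) 1 = 1 \<and> q (Suc ?n) 2 = -1" using step[of ?n] by simp
      then show ?thesis using step[of "Suc ?n"] by (intro exI[of _ "Suc (Suc ?n)"]) simp
    qed
  qed
  then obtain n0 where n0: "m + 2 \<le> n0" "q n0 1 = -1" "q n0 2 = 1" by blast
  have cycle: "q n 1 = -1 \<and> q n 2 = 1 \<Longrightarrow> m + 2 \<le> n \<Longrightarrow>
      q n 3 = 1 \<and> q (Suc n) 1 = 1 \<and> q (Suc n) 2 = 1 \<and> q (Suc n) 3 = -1 \<and>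
      q (Suc (Suc n)) 1 = 1 \<and> q (Suc (Suc n)) 2 = -1 \<and> q (Suc (Suc n)) 3 = 1 \<and>
      q (Suc (Suc (Suc n))) 1 = -1 \<and> q (Suc (Suc (Suc n))) 2 = 1 \<and> q (Suc (Suc (Suc n))) 3 = 1" for n
    using step[of n] step[of "Suc n"] step[of "Suc (Suc n)"]
      next3[of n] next3[of "Suc n"] next3[of "Suc (Suc n)"] next3[of "Suc (Suc (Suc n))"] by simp
  have per: "q (n0 + 3 * k) 1 = -1 \<and> q (n0 + 3 * k) 2 = 1" for k
  proof (induction k)
    case (Suc k)
    then show ?case using cycle[of "n0 + 3 * k"] n0(1) by (simp add: eval_nat_numeral)
  qed (use n0 in simp)
  have vec: "fst (f n) = vector [r, s, t]" if "q n 1 = r" "q n 2 = s" "q n 3 = t" for n r s t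
    using that by (simp add: q_def vec_eq_iff forall_3)
  \<comment> \<open>The step leaving level \<open>n0\<close> uses the digits with index
    \<open>Suc n0\<close>.\<close>
  have "exceptional (Suc n0)"
    unfolding exceptional_def
  proof
    fix k
    let ?n = "n0 + 3 * k"
    have "m + 2 \<le> ?n" using n0(1) by simp
    note c = cycle[OF per this]
    have "orbit ?n f" using orbit_mono[OF f] n0(1) by simp
    from cycle_conditions[OF this vec vec vec vec] per[of k] c
    show "a (Suc n0 + 3 * k) = 0 \<and> a (Suc n0 + 3 * k + 1) = b (Suc n0 + 3 * k + 1) \<and>
      0 < a (Suc n0 + 3 * k + 2) \<and> a (Suc n0 + 3 * k + 2) < b (Suc n0 + 3 * k + 2)"
      by simp
  qed
  then show ?thesis by (intro exI[of _ "Suc n0"]) simp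
qed

section \<open>Ancestors at every level and the covering of the initial plane\<close>

lemma ancestor_plane:
  "ancestor a b n f g \<Longrightarrow> g \<in> plane (w n) \<Longrightarrow> f \<in> plane (w 0)"
  by (induction n arbitrary: g) (auto dest: par_plane)

lemma ancestor_unique:
  "ancestor a b n f g \<Longrightarrow> ancestor a b n f g' \<Longrightarrow> g \<in> plane (w n) \<Longrightarrow> g' \<in> plane (w n) \<Longrightarrow> g = g'"
proof (induction n arbitrary: g g')
  case (Suc n)
  then obtain h h' where h: "ancestor a b n f h" "par n h g" "ancestor a b n f h'" "par n h' g'"
    by auto
  then have "h = h'" using Suc par_plane by blast
  then show ?case using h Suc.prems par_unique by blast
qed simp

text \<open>Every letter occurs in some image, and the base-point equation is solvable over the
  integers. This serves to pull a periodic face down to level 0.\<close>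

lemma ex_child: "\<exists>f. par n f g"
proof -
  obtain x i where g: "g = (x, i)" by (cases g)
  have "i = 1 \<or> i = 2 \<or> i = 3" by (rule exhaust_3)
  then have "\<exists>c j. j = 1 \<and> i = 3 \<and> c = 0 \<or>
      j = 2 \<and> (i = 3 \<and> c < a (Suc n) \<or> i = 1 \<and> c = a (Suc n)) \<or>
      j = (3::3) \<and> (i = 3 \<and> c < b (Suc n) \<or> i = 2 \<and> c = b (Suc n))"
    by auto
  then obtain c j where "j = 1 \<and> i = 3 \<and> c = 0 \<or>
      j = 2 \<and> (i = 3 \<and> c < a (Suc n) \<or> i = 1 \<and> c = a (Suc n)) \<or>
      j = (3::3) \<and> (i = 3 \<and> c < b (Suc n) \<or> i = 2 \<and> c = b (Suc n))" by blast
  then have "par n (vector [x$3 - int (a (Suc n)) * x$1 - int (b (Suc n)) * x$2 + int c, x$1, x$2], j) g"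
    unfolding g parent_def by (auto intro!: exI[of _ c])
  then show ?thesis by blast
qed

lemma ex_descendant: "\<exists>f. ancestor a b n f g"
proof (induction n arbitrary: g)
  case (Suc n)
  then show ?case using ex_child by (metis ancestor.simps(2))
qed simp

lemma orbit_ancestor:
  assumes "orbit 0 f" shows "ancestor a b n (f 0) (f n)"
proof (induction n)
  case (Suc n)
  then show ?case using assms unfolding ancestor.simps orbit_def by blast
qed simp

lemma not_exceptional_covers:
  assumes "\<not> (\<exists>l\<ge>1. exceptional l)" "f0 \<in> plane (w 0)"
  shows "\<exists>n. \<exists>g\<in>U_faces. ancestor a b n f0 g"
proof -
  obtain f where f: "f 0 = f0" "orbit 0 f" using ex_orbit[OF assms(2)] by blast
  have "\<exists>n\<ge>0. fst (f n) = 0"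
    using trapped_orbit_exceptional assms(1) by (intro orbits_reach_zero[OF _ f(2)]) blast
  then obtain n where "fst (f n) = 0" by blast
  then have "f n \<in> U_faces" by (cases "f n") (simp add: U_faces_def)
  then show ?thesis using orbit_ancestor[OF f(2), of n] f(1) by auto
qed

text \<open>A level-0 descendant of \<open>?A\<close> has \<open>?A\<close>, via \<open>?B\<close>
  and \<open>?C\<close>, as its only ancestor in the plane at every level \<open>m + 3 * k\<close>.
  An ancestor in U would contradict this uniqueness.\<close>

lemma exceptional_uncovered:
  assumes "exceptional (Suc m)"
  shows "\<exists>f\<in>plane (w 0). \<forall>n. \<forall>g\<in>U_faces. \<not> ancestor a b n f g"
proof -
  let ?A = "(vector [-1, 1, 1], 3) :: cface"
  let ?B = "(vector [1, 1, -1], 2) :: cface"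
  let ?C = "(vector [1, -1, 1], 3) :: cface"
  have ex: "a (Suc (m + 3 * k)) = 0" "a (Suc (Suc (m + 3 * k))) = b (Suc (Suc (m + 3 * k)))"
     "0 < a (Suc (Suc (Suc (m + 3 * k))))"
     "a (Suc (Suc (Suc (m + 3 * k)))) < b (Suc (Suc (Suc (m + 3 * k))))" for k
    using assms unfolding exceptional_def by (auto dest!: spec[of _ k])
  \<comment> \<open>The height is \<open>w2 + w3 - w1\<close>, and a zero digit means that
    \<open>w2\<close> is below \<open>w1\<close>, which is at most \<open>w3\<close>.\<close>
  have A_plane: "?A \<in> plane (w (m + 3 * k))" for k
    using a_eq_0_iff[of "m + 3 * k"] ex(1)[of k] le_third[of "m + 3 * k" 1] pos[of "m + 3 * k" 2]
    by (simp add: plane_def height_def)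
  obtain f where f: "ancestor a b m f ?A" using ex_descendant by blast
  have f_A: "ancestor a b (m + 3 * k) f ?A" for k
  proof (induction k)
    case (Suc k)
    let ?n = "m + 3 * k"
    have "par ?n ?A ?B"
      using ex(1)[of k] by (simp add: parent_def)
    moreover have "par (Suc ?n) ?B ?C"
      using ex(2)[of k] b_pos[of "Suc ?n"] by (simp add: parent_def)
    moreover have "par (Suc (Suc ?n)) ?C ?A"
      using ex(3,4)[of k] unfolding parent_def
      \<comment> \<open>The third-coordinate equation gives \<open>c = b - a\<close>; a positive
        \<open>a\<close> keeps it below \<open>b\<close>, so the type remains 3.\<close>
      by (auto intro!: exI[of _ "b (Suc (Suc (Suc ?n))) - a (Suc (Suc (Suc ?n)))"])
    ultimately have "ancestor a b (Suc (Suc (Suc ?n))) f ?A"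
      using Suc unfolding ancestor.simps by blast
    then show ?case by (simp add: eval_nat_numeral)
  qed (simp add: f)
  have "\<not> ancestor a b n f g" if g: "g \<in> U_faces" for n g
  proof
    assume "ancestor a b n f g"
    then have "f \<in> {f. \<exists>g\<in>U_faces. ancestor a b n f g}" using g by blast
    \<comment> \<open>Monotonicity moves an ancestor in U up to a level where \<open>?A\<close> is
      known to be the ancestor.\<close>
    moreover have "n \<le> m + 3 * n" by simp
    ultimately obtain g' where g': "g' \<in> U_faces" "ancestor a b (m + 3 * n) f g'"
      using incseq_ancestor_U[of a b] unfolding incseq_def by blast
    have "g' \<in> plane (w (m + 3 * n))" using g'(1) zero_mem_plane by (auto simp: U_faces_def)
    then have "g' = ?A" using ancestor_unique[OF g'(2) f_A] A_plane by blast
    then have "vector [-1, 1, 1] = (0 :: int^3)" using g'(1) by (simp add: U_faces_def)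
    then show False by (simp add: vec_eq_iff forall_3)
  qed
  moreover have "f \<in> plane (w 0)" using ancestor_plane[OF f] A_plane[of 0] by simp
  ultimately show ?thesis by blast
qed

end

section \<open>From the floor-based expansion to the backward recurrences\<close>

lemma JP_orbit_of_expansion:
  assumes adm: "JP_admissible a b" and pos: "\<And>i. 0 < v $ i" and exp: "JP_expansion v a b"
  shows "JP_orbit a b (\<lambda>n. (JP_map ^^ n) v)"
proof -
  define w where "w n = (JP_map ^^ n) v" for n
  have w0: "w 0 = v" by (simp add: w_def)
  have ex: "w n $ 1 \<noteq> 0" "int (a (Suc n)) = \<lfloor>w n $ 2 / w n $ 1\<rfloor>"
    "int (b (Suc n)) = \<lfloor>w n $ 3 / w n $ 1\<rfloor>" for n
    using exp unfolding JP_expansion_def Let_def by (auto dest!: spec[of _ "Suc n"] simp: w_def)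
  have "w (Suc n) = JP_map (w n)" for n by (simp add: w_def)
  then have wS: "w (Suc n) $ 1 = w n $ 2 - a (Suc n) * w n $ 1"
    "w (Suc n) $ 2 = w n $ 3 - b (Suc n) * w n $ 1" "w (Suc n) $ 3 = w n $ 1" for n
    by (simp_all add: JP_map_def flip: ex(2,3))
  have rem: "0 \<le> w (Suc n) $ 1" "w (Suc n) $ 1 < w n $ 1"
    "0 \<le> w (Suc n) $ 2" "w (Suc n) $ 2 < w n $ 1" if "0 < w n $ 1" for n
  proof -
    have "real (a (Suc n)) \<le> w n $ 2 / w n $ 1" "w n $ 2 / w n $ 1 < real (a (Suc n)) + 1"
      "real (b (Suc n)) \<le> w n $ 3 / w n $ 1" "w n $ 3 / w n $ 1 < real (b (Suc n)) + 1"
      using floor_correct[of "w n $ 2 / w n $ 1", folded ex(2)]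
        floor_correct[of "w n $ 3 / w n $ 1", folded ex(3)] by simp_all
    then show "0 \<le> w (Suc n) $ 1" "w (Suc n) $ 1 < w n $ 1"
      "0 \<le> w (Suc n) $ 2" "w (Suc n) $ 2 < w n $ 1"
      using that by (simp_all add: wS field_simps)
  qed
  \<comment> \<open>\<open>JP_expansion\<close> only demands a nonzero divisor; remainders are
    nonnegative, so it is positive.\<close>
  have pos1: "0 < w n $ 1" for n
  proof (induction n)
    case (Suc n)
    then show ?case using rem(1)[of n] ex(1)[of "Suc n"] by linarith
  qed (simp add: w0 pos)
  have pos2: "0 < w n $ 2" for n
  proof (cases n)
    case (Suc m)
    \<comment> \<open>A zero second coordinate would give digit 0 and hence a zero divisor at the
      next level.\<close>
    have "w (Suc m) $ 2 \<noteq> 0"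
    proof
      assume "w (Suc m) $ 2 = 0"
      then have "w (Suc (Suc m)) $ 1 = 0" using ex(2)[of "Suc m"] by (simp add: wS(1)[of "Suc m"])
      then show False using ex(1) by simp
    qed
    then show ?thesis using rem(3)[OF pos1, of m] Suc by simp
  qed (simp add: w0 pos)
  have pos3: "0 < w n $ 3" for n
    by (cases n) (simp_all add: w0 pos wS(3) pos1)
  have le3: "w n $ 1 \<le> w n $ 3" "w n $ 2 \<le> w n $ 3" for n
  proof -
    show "w n $ 1 \<le> w n $ 3" "w n $ 2 \<le> w n $ 3"
      using exp rem(2,4)[OF pos1]
      by (cases n; simp add: w0 JP_expansion_def wS(3) less_imp_le)+
  qed
  have admS: "a (Suc n) \<le> b (Suc n)" "0 < b (Suc n)"
    "a (Suc n) = b (Suc n) \<Longrightarrow> a (Suc (Suc n)) \<noteq> 0" for n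
    using adm unfolding JP_admissible_def by (auto dest!: spec[of _ "Suc n"])
  have "JP_orbit a b w"
  proof
    fix n and i :: 3
    have i: "i = 1 \<or> i = 2 \<or> i = 3" by (rule exhaust_3)
    show "0 < w n $ i" using i pos1 pos2 pos3 by auto
    show "w n $ i \<le> w n $ 3" using i le3 by auto
    show "w (Suc n) $ 1 < w (Suc n) $ 3" "w (Suc n) $ 2 < w (Suc n) $ 3"
      using rem(2,4)[OF pos1] by (simp_all add: wS(3))
  qed (use admS in \<open>simp_all add: wS\<close>)
  then show ?thesis by (simp add: w_def[abs_def])
qed

theorem theorem5p3:
  fixes a b :: "nat \<Rightarrow> nat" and P :: "nat \<Rightarrow> (real^3) set"
  assumes "JP_admissible a b"
    and "\<And>n. P n = Sigma_JP_prod a b n U"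
  shows "(\<forall>n. is_pattern (P n)) \<and> incseq P \<and>
    (\<forall>v::real^3. (\<forall>i. 0 < v $ i) \<and> JP_expansion v a b \<longrightarrow>
       (\<forall>n. P n \<subseteq> discrete_plane v) \<and>
       ((\<Union>n. P n) \<subset> discrete_plane v \<longleftrightarrow>
          (\<exists>l\<ge>1. \<forall>k. a (l + 3 * k) = 0 \<and>
             a (l + 3 * k + 1) = b (l + 3 * k + 1) \<and>
             0 < a (l + 3 * k + 2) \<and> a (l + 3 * k + 2) < b (l + 3 * k + 2))))"
proof -
  define F where "F n = {f. \<exists>g\<in>U_faces. ancestor a b n f g}" for n
  have P: "P n = realize (F n)" for n
    unfolding assms(2) U_eq Sigma_JP_prod_realize F_def ..
  have "finite U_faces" by (simp add: U_faces_def)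
  then have "is_pattern (P n)" for n
    using finite_ancestor unfolding is_pattern_def P realize_def F_def by blast
  moreover have "incseq P"
    using incseq_ancestor_U[of a b] unfolding incseq_def P realize_subset_iff F_def by blast
  moreover have "(\<forall>n. P n \<subseteq> discrete_plane v) \<and>
       ((\<Union>n. P n) \<subset> discrete_plane v \<longleftrightarrow>
          (\<exists>l\<ge>1. \<forall>k. a (l + 3 * k) = 0 \<and>
             a (l + 3 * k + 1) = b (l + 3 * k + 1) \<and>
             0 < a (l + 3 * k + 2) \<and> a (l + 3 * k + 2) < b (l + 3 * k + 2)))"
    if v: "\<forall>i. 0 < v $ i" "JP_expansion v a b" for v
  proof -
    interpret JP_orbit a b "\<lambda>n. (JP_map ^^ n) v"
      using assms(1) v by (intro JP_orbit_of_expansion) auto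
    \<comment> \<open>An ancestor in U thus lies in the plane of its level, and
      \<open>ancestor_plane\<close> brings the face back to the plane of \<open>v\<close>.\<close>
    have "U_faces \<subseteq> plane ((JP_map ^^ n) v)" for n
      using zero_mem_plane by (auto simp: U_faces_def)
    then have sub: "F n \<subseteq> plane v" for n
      using ancestor_plane unfolding F_def by fastforce
    then have "(\<Union>n. F n) \<subseteq> plane v"
      by (rule UN_least)
    then have "(\<Union>n. F n) \<subset> plane v \<longleftrightarrow> \<not> plane v \<subseteq> (\<Union>n. F n)"
      by (simp add: less_le_not_le)
    also have "\<dots> \<longleftrightarrow> (\<exists>f\<in>plane v. \<forall>n. f \<notin> F n)"
      by (simp add: subset_iff Bex_def del: split_paired_Ex split_paired_All)
    also have "\<dots> \<longleftrightarrow> (\<exists>l\<ge>1. exceptional l)"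
    proof
      assume "\<exists>f\<in>plane v. \<forall>n. f \<notin> F n"
      then show "\<exists>l\<ge>1. exceptional l"
        using not_exceptional_covers unfolding F_def by fastforce
    next
      assume "\<exists>l\<ge>1. exceptional l"
      \<comment> \<open>\<open>exceptional_uncovered\<close> refers to the level before digit
        \<open>l\<close>, which exists because \<open>l\<close> is at least 1.\<close>
      then obtain m where "exceptional (Suc m)" by (metis One_nat_def Suc_le_D)
      from exceptional_uncovered[OF this] show "\<exists>f\<in>plane v. \<forall>n. f \<notin> F n"
        unfolding F_def by simp
    qed
    finally have "(\<Union>n. F n) \<subset> plane v \<longleftrightarrow> (\<exists>l\<ge>1. exceptional l)" .
    then show ?thesis
      using sub unfolding P realize_UN discrete_plane_eq realize_subset_iff realize_psubset_iff
        exceptional_def by simp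
  qed
  ultimately show ?thesis by simp
qed

end
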